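(* If a graph $G\in G_{m,n}$ is bipartite with parts $V_1$ and $V_2$, $|V_1|\le |V_2|$, then one of the following conditions holds: 1) $|V_1|=|V_2|$ and $n=m+2$ and $m,n$ are even; 2) $|V_1|=m$ and $|V_2|=n$ and $n=m+1$; 3) $|V_1|=|V_2|$ and $m=n$. Moreover, in the first case $G$ is Hamiltonian, in the second case $G$ is traceable, and in the third case $G$ is Hamiltonian.
   Context: All graphs are finite and simple. For positive integers $m,n$, $G_{m,n}$ denotes the class of all simple graphs that have the same degree sequence as the disjoint union $K_m\cup K_n$ of two cliques (that is, $m$ vertices of degree $m-1$ and $n$ further vertices of degree $n-1$) but are different from (not isomorphic to) $K_m\cup K_n$. A graph is bipartite with parts $V_1,V_2$ if $V_1,V_2$ are nonempty independent sets partitioning its vertex set. A graph is Hamiltonian if it has a cycle visiting every vertex exactly once, and traceable if it has a path visiting every vertex exactly once.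
   Formalization: The order m ≤ n is assumed; without it the claim fails: for m=3, n=2 the path on five vertices is a bipartite member of G_{3,2} with parts of sizes 2 and 3 and satisfies none of the three conditions. As G_{m,n}=G_{n,m}, no graph is lost. *)

theory Defs
  imports "Graph_Theory.Graph_Theory" "HOL-Library.Multiset"
begin

text \<open>
  A finite simple graph is a \<^locale>\<open>pair_graph\<close>: a finite vertex set together with a symmetric,
  irreflexive adjacency relation on it. Each edge \<open>uv\<close> is thus represented by the two arcs
  \<open>(u, v)\<close> and \<open>(v, u)\<close>, so the degree of a vertex is its out-degree.
\<close>

definition degree_sequence :: "'a pair_pre_digraph \<Rightarrow> nat multiset" where
  "degree_sequence G = image_mset (out_degree (with_proj G)) (mset_set (pverts G))"

definition disjoint_cliques :: "nat \<Rightarrow> nat \<Rightarrow> (nat + nat) pair_pre_digraph" where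
  "disjoint_cliques m n =
     \<lparr> pverts = {..<m} <+> {..<n},
       parcs = {(Inl i, Inl j) | i j. i < m \<and> j < m \<and> i \<noteq> j}
             \<union> {(Inr i, Inr j) | i j. i < n \<and> j < n \<and> i \<noteq> j} \<rparr>"

lemma pair_graph_disjoint_cliques: "pair_graph (disjoint_cliques m n)"
proof -
  have "parcs (disjoint_cliques m n) \<subseteq>
      pverts (disjoint_cliques m n) \<times> pverts (disjoint_cliques m n)"
    by (auto simp: disjoint_cliques_def)
  moreover have fin: "finite (pverts (disjoint_cliques m n))"
    by (simp add: disjoint_cliques_def)
  ultimately have "finite (parcs (disjoint_cliques m n))"
    by (meson finite_SigmaI finite_subset)
  with fin show ?thesis
    by unfold_locales (auto simp: disjoint_cliques_def symmetric_def sym_def)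
qed

lemma degree_sequence_disjoint_cliques:
  "degree_sequence (disjoint_cliques m n) =
     replicate_mset m (m - 1) + replicate_mset n (n - 1)"
proof -
  let ?d = "out_degree (with_proj (disjoint_cliques m n))"
  have l: "?d (Inl i) = m - 1" if "i < m" for i
  proof -
    have "out_arcs (with_proj (disjoint_cliques m n)) (Inl i) =
        (\<lambda>j. (Inl i, Inl j)) ` ({..<m} - {i})"
      using that by (auto simp: out_arcs_def disjoint_cliques_def)
    then show ?thesis
      using that by (simp add: out_degree_def card_image inj_on_def)
  qed
  have r: "?d (Inr i) = n - 1" if "i < n" for i
  proof -
    have "out_arcs (with_proj (disjoint_cliques m n)) (Inr i) =
        (\<lambda>j. (Inr i, Inr j)) ` ({..<n} - {i})"
      using that by (auto simp: out_arcs_def disjoint_cliques_def)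
    then show ?thesis
      using that by (simp add: out_degree_def card_image inj_on_def)
  qed
  have "mset_set (pverts (disjoint_cliques m n)) =
      image_mset Inl (mset_set {..<m}) + image_mset Inr (mset_set {..<n})"
    unfolding disjoint_cliques_def Plus_def pair_pre_digraph.simps
    by (subst mset_set_Union) (auto simp: image_mset_mset_set)
  moreover have "image_mset (\<lambda>i. ?d (Inl i)) (mset_set {..<m}) = replicate_mset m (m - 1)"
  proof -
    have "image_mset (\<lambda>i. ?d (Inl i)) (mset_set {..<m}) = image_mset (\<lambda>_. m - 1) (mset_set {..<m})"
      using l by (intro image_mset_cong) simp
    then show ?thesis
      by (simp add: image_mset_const_eq)
  qed
  moreover have "image_mset (\<lambda>i. ?d (Inr i)) (mset_set {..<n}) = replicate_mset n (n - 1)"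
  proof -
    have "image_mset (\<lambda>i. ?d (Inr i)) (mset_set {..<n}) = image_mset (\<lambda>_. n - 1) (mset_set {..<n})"
      using r by (intro image_mset_cong) simp
    then show ?thesis
      by (simp add: image_mset_const_eq)
  qed
  ultimately show ?thesis
    by (simp add: degree_sequence_def image_mset.compositionality comp_def)
qed

definition clique_pair_class :: "nat \<Rightarrow> nat \<Rightarrow> 'a pair_pre_digraph set" where
  "clique_pair_class m n =
     {G. pair_graph G \<and>
         degree_sequence G = degree_sequence (disjoint_cliques m n) \<and>
         \<not> digraph_iso (with_proj G) (with_proj (disjoint_cliques m n))}"

text \<open>The class depends only on the unordered pair, so one may always take \<open>m \<le> n\<close>.\<close>

lemma clique_pair_class_commute: "clique_pair_class m n = clique_pair_class n m"
proof -
  let ?s = "\<lambda>x :: nat + nat. case x of Inl i \<Rightarrow> Inr i | Inr i \<Rightarrow> Inl i"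
  have swap: "digraph_iso (with_proj (disjoint_cliques m n)) (with_proj (disjoint_cliques n m))"
    for m n
  proof -
    interpret pair_graph "disjoint_cliques m n" by (rule pair_graph_disjoint_cliques)
    let ?f = "\<lparr> iso_verts = ?s, iso_arcs = map_prod ?s ?s, iso_head = snd, iso_tail = fst \<rparr>"
    have inj: "inj ?s"
      by (auto simp: inj_def split: sum.splits)
    have "digraph_isomorphism ?f"
      unfolding digraph_isomorphism_def
      using inj_on_subset[OF inj] inj_on_subset[OF prod.inj_map[OF inj inj]]
      by (simp add: wf_digraph)
    moreover have "with_proj (disjoint_cliques n m) = app_iso ?f (with_proj (disjoint_cliques m n))"
    proof -
      have "?s ` ({..<m} <+> {..<n}) = {..<n} <+> {..<m}"
        by (simp add: Plus_def image_Un image_image Un_commute)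
      moreover have "map_prod ?s ?s ` parcs (disjoint_cliques m n) = parcs (disjoint_cliques n m)"
      proof (intro equalityI subsetI)
        fix e assume "e \<in> map_prod ?s ?s ` parcs (disjoint_cliques m n)"
        then show "e \<in> parcs (disjoint_cliques n m)"
          by (auto simp: disjoint_cliques_def)
      next
        fix e assume "e \<in> parcs (disjoint_cliques n m)"
        then have "map_prod ?s ?s e \<in> parcs (disjoint_cliques m n)"
          and "e = map_prod ?s ?s (map_prod ?s ?s e)"
          by (auto simp: disjoint_cliques_def)
        then show "e \<in> map_prod ?s ?s ` parcs (disjoint_cliques m n)"
          by blast
      qed
      ultimately show ?thesis
        by (simp add: app_iso_def with_proj_def disjoint_cliques_def)
    qed
    ultimately show ?thesis
      unfolding digraph_iso_def by blast
  qed
  have "digraph_iso G (with_proj (disjoint_cliques m n)) =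
        digraph_iso G (with_proj (disjoint_cliques n m))" for G :: "('b, 'b \<times> 'b) pre_digraph"
    using swap digraph_iso_trans by blast
  then show ?thesis
    by (auto simp: clique_pair_class_def degree_sequence_disjoint_cliques add.commute)
qed

definition independent_set :: "'a pair_pre_digraph \<Rightarrow> 'a set \<Rightarrow> bool" where
  "independent_set G S \<longleftrightarrow> S \<subseteq> pverts G \<and> (\<forall>u\<in>S. \<forall>v\<in>S. (u, v) \<notin> parcs G)"

definition bipartite_with_parts :: "'a pair_pre_digraph \<Rightarrow> 'a set \<Rightarrow> 'a set \<Rightarrow> bool" where
  "bipartite_with_parts G V1 V2 \<longleftrightarrow>
     V1 \<noteq> {} \<and> V2 \<noteq> {} \<and> V1 \<inter> V2 = {} \<and> V1 \<union> V2 = pverts G \<and>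
     independent_set G V1 \<and> independent_set G V2"

text \<open>
  The length bound excludes the closed walk \<open>u, v, u\<close> along a single edge, which is a cycle of the
  symmetric digraph but not of the graph. The vertices on a cycle are the tails of its arcs.
\<close>

definition hamiltonian :: "'a pair_pre_digraph \<Rightarrow> bool" where
  "hamiltonian G \<longleftrightarrow>
     (\<exists>p. pre_digraph.cycle (with_proj G) p \<and> 3 \<le> length p \<and> fst ` set p = pverts G)"

definition traceable :: "'a pair_pre_digraph \<Rightarrow> bool" where
  "traceable G \<longleftrightarrow>
     (\<exists>u p v. pre_digraph.apath (with_proj G) u p v \<and>
       set (pre_digraph.awalk_verts (with_proj G) u p) = pverts G)"

end

theory Submission
  imports Defs
begin

text \<open>
  Call a vertex high if its degree is \<open>n - 1\<close>.

  Sizes of the parts. The degree of a vertex is at most the size of the opposite part. For \<open>m < n\<close>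
  the larger part contains a high vertex: otherwise all \<open>n\<close> of them lie in the smaller part, and
  both parts together have at least \<open>2 n > m + n\<close> vertices. So the smaller part has at least
  \<open>n - 1\<close> vertices, hence \<open>m + n \<ge> 2 (n - 1)\<close>, which leaves parts \<open>m + 1, m + 1\<close> with
  \<open>n = m + 2\<close>, or parts \<open>m, n\<close> with \<open>n = m + 1\<close> (lemma \<open>part_sizes_if_less\<close>). For \<open>m = n\<close> the
  graph is regular and the parts are equal. Counting the edges from both sides
  (lemma \<open>edge_count\<close>) then locates the high vertices exactly.

  Parts \<open>m + 1, m + 1\<close>. Half of the high vertices lie in each part, so \<open>n\<close> is even, and each part
  consists of \<open>m / 2 + 1\<close> high and \<open>m / 2\<close> other vertices. A high vertex is adjacent to the whole
  opposite part. A walk that alternates between the high vertices of \<open>V1\<close> and the others of \<open>V2\<close>,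
  and then between the high vertices of \<open>V2\<close> and the others of \<open>V1\<close>, uses only such edges and
  closes up to a Hamiltonian cycle (lemma \<open>hamiltonian_if_add_2\<close>).

  Parts \<open>n, n\<close> with \<open>m = n\<close>, and parts \<open>m, n\<close> with \<open>n = m + 1\<close>. Here every vertex of \<open>V1\<close> misses
  exactly one vertex of \<open>V2\<close>, and every vertex of \<open>V2\<close> misses at most one of \<open>V1\<close>. Hence the graph
  is a complete bipartite graph minus a matching of size \<open>m\<close>: vertices can be numbered so that
  \<open>u i\<close> and \<open>v j\<close> are adjacent iff \<open>i \<noteq> j\<close> (lemma \<open>ex_crown_enumeration\<close>). For \<open>n \<ge> 3\<close>, placing
  \<open>u i\<close> between \<open>v (i + 1)\<close> and \<open>v (i + 2)\<close>, indices modulo \<open>n\<close>, gives a Hamiltonian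
  cycle when \<open>m = n\<close> and a Hamiltonian path when \<open>n = m + 1\<close>. The graphs of this kind with \<open>n \<le> 2\<close> are disjoint unions of two cliques, and
  these the class excludes.
\<close>

section \<open>Enumerating finite sets\<close>

lemma bij_betw_shift_mod:
  assumes "0 < (n :: nat)"
  shows "bij_betw (\<lambda>i. (i + k) mod n) {..<n} {..<n}"
proof -
  have inj: "inj_on (\<lambda>i. (i + k) mod n) {..<n}"
  proof (rule linorder_inj_onI)
    fix i j assume "i < j" and "i \<in> {..<n}" and "j \<in> {..<n}"
    then have "\<not> n dvd (j + k) - (i + k)"
      by (auto dest: dvd_imp_le)
    then show "(i + k) mod n \<noteq> (j + k) mod n"
      using mod_eq_dvd_iff_nat[of "i + k" "j + k" n] \<open>i < j\<close> by simp
  qed auto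
  moreover have "(\<lambda>i. (i + k) mod n) ` {..<n} \<subseteq> {..<n}"
    using assms by auto
  ultimately show ?thesis
    by (simp add: bij_betw_def endo_inj_surj)
qed

lemma shift_mod_neq:
  fixes i k n :: nat
  assumes "0 < k" and "k < n"
  shows "(i + k) mod n \<noteq> i mod n"
  using assms mod_eq_dvd_iff_nat[of i "i + k" n] by (auto dest: dvd_imp_le)

lemma ex_enumeration_extending_subset:
  assumes "finite S" and "F \<subseteq> S"
  shows "\<exists>x. bij_betw x {..<card S} S \<and> x ` {..<card F} = F"
proof -
  obtain f where f: "bij_betw f {..<card F} F"
    using assms finite_subset by (metis bij_betw_from_nat_into_finite)
  obtain g where g: "bij_betw g {card F..<card S} (S - F)"
  proof -
    have "card {card F..<card S} = card (S - F)"
      using assms by (simp add: card_Diff_subset finite_subset)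
    then show ?thesis
      using that assms(1) by (metis finite_Diff finite_atLeastLessThan finite_same_card_bij)
  qed
  let ?x = "\<lambda>i. if i \<in> {..<card F} then f i else g i"
  have le: "card F \<le> card S"
    using assms by (simp add: card_mono)
  have "bij_betw ?x ({..<card F} \<union> {card F..<card S}) (F \<union> (S - F))"
    by (rule bij_betw_disjoint_Un[OF f g]) auto
  moreover have "{..<card F} \<union> {card F..<card S} = {..<card S}"
    using le by auto
  moreover have "F \<union> (S - F) = S"
    using assms(2) by auto
  moreover have "?x ` {..<card F} = F"
    using f by (simp add: bij_betw_def)
  ultimately show ?thesis
    by metis
qed

text \<open>
  The sequence \<open>f 0, g 0, f 1, g 1, \<dots>\<close>: this is how a path or cycle runs through a
  bipartite graph, with \<open>f\<close> in one part and \<open>g\<close> in the other.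
\<close>

definition interleave :: "(nat \<Rightarrow> 'a) \<Rightarrow> (nat \<Rightarrow> 'a) \<Rightarrow> nat \<Rightarrow> 'a" where
  "interleave f g i = (if even i then f (i div 2) else g (i div 2))"

lemma interleave_simps [simp]:
  "interleave f g (2 * i) = f i"
  "interleave f g (Suc (2 * i)) = g i"
  "interleave f g (Suc (Suc (2 * i))) = f (Suc i)"
  by (simp_all add: interleave_def)

lemma bij_betw_interleave:
  assumes f: "bij_betw f {..<j} A" and g: "bij_betw g {..<k} B" and "A \<inter> B = {}"
    and "k \<le> j" and "j \<le> Suc k"
  shows "bij_betw (interleave f g) {..<j + k} (A \<union> B)"
proof (rule bij_betw_imageI)
  have even_less: "i < j" if "2 * i < j + k" for i
    using that assms(4,5) by linarith
  have odd_less: "i < k" if "Suc (2 * i) < j + k" for i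
    using that assms(4,5) by linarith
  have fA: "f i \<in> A" if "i < j" for i
    using that f by (auto simp: bij_betw_def)
  have gB: "g i \<in> B" if "i < k" for i
    using that g by (auto simp: bij_betw_def)
  have inj_f: "f i = f i' \<longleftrightarrow> i = i'" if "i < j" "i' < j" for i i'
    using that f by (auto simp: bij_betw_def inj_on_def)
  have inj_g: "g i = g i' \<longleftrightarrow> i = i'" if "i < k" "i' < k" for i i'
    using that g by (auto simp: bij_betw_def inj_on_def)
  have disj: "f i \<noteq> g i'" if "i < j" "i' < k" for i i'
    using fA[OF that(1)] gB[OF that(2)] assms(3) by auto
  have parity: "\<exists>i. a = 2 * i \<or> a = Suc (2 * i)" for a :: nat
    by presburger
  show "inj_on (interleave f g) {..<j + k}"
  proof (rule inj_onI)
    fix a b assume ab: "a \<in> {..<j + k}" "b \<in> {..<j + k}"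
      and eq: "interleave f g a = interleave f g b"
    obtain i i' where "a = 2 * i \<or> a = Suc (2 * i)" and "b = 2 * i' \<or> b = Suc (2 * i')"
      using parity by metis
    then show "a = b"
      using ab eq disj[of i i'] disj[of i' i] inj_f[of i i'] inj_g[of i i']
        even_less odd_less by auto
  qed
  show "interleave f g ` {..<j + k} = A \<union> B"
  proof (intro equalityI subsetI)
    fix z assume "z \<in> interleave f g ` {..<j + k}"
    then obtain a where "a < j + k" and z: "z = interleave f g a"
      by auto
    moreover obtain i where "a = 2 * i \<or> a = Suc (2 * i)"
      using parity by metis
    ultimately show "z \<in> A \<union> B"
      using fA gB even_less odd_less by auto
  next
    fix z assume "z \<in> A \<union> B"
    then consider i where "i < j" "z = f i" | i where "i < k" "z = g i"
      using f g by (auto simp: bij_betw_def)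
    then show "z \<in> interleave f g ` {..<j + k}"
    proof cases
      case 1
      then have "2 * i < j + k" using assms(4,5) by linarith
      then show ?thesis using 1 by (intro image_eqI[of _ _ "2 * i"]) auto
    next
      case 2
      then have "Suc (2 * i) < j + k" using assms(4,5) by linarith
      then show ?thesis using 2 by (intro image_eqI[of _ _ "Suc (2 * i)"]) auto
    qed
  qed
qed

section \<open>Paths, cycles and isomorphisms from enumerations\<close>

context pair_wf_digraph
begin

lemma awalk_of_sequence:
  assumes "c 0 \<in> pverts G" and "\<And>i. i < k \<Longrightarrow> (c i, c (Suc i)) \<in> parcs G"
  defines "p \<equiv> map (\<lambda>i. (c i, c (Suc i))) [0..<k]"
  shows "awalk (c 0) p (c k)" and "pawalk_verts (c 0) p = map c [0..<Suc k]"
proof -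
  have *: "awalk (c 0) (map (\<lambda>i. (c i, c (Suc i))) [0..<k]) (c k) \<and>
      pawalk_verts (c 0) (map (\<lambda>i. (c i, c (Suc i))) [0..<k]) = map c [0..<Suc k]"
    using assms(1,2)
  proof (induction k)
    case 0
    then show ?case by (simp add: awalk_Nil_iff)
  next
    case (Suc k)
    then have "(c k, c (Suc k)) \<in> parcs G"
      by simp
    then have "c (Suc k) \<in> pverts G"
      by (rule in_arcsD2)
    with Suc show ?case
      by (simp add: awalk_Nil_iff awalk_Cons_iff awalk_verts_append)
  qed
  then show "awalk (c 0) p (c k)" and "pawalk_verts (c 0) p = map c [0..<Suc k]"
    unfolding p_def by auto
qed

lemma traceable_if_enumeration:
  assumes c: "bij_betw c {..<Suc k} (pverts G)"
    and arcs: "\<And>i. i < k \<Longrightarrow> (c i, c (Suc i)) \<in> parcs G"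
  shows "traceable G"
proof -
  let ?p = "map (\<lambda>i. (c i, c (Suc i))) [0..<k]"
  have "c 0 \<in> pverts G"
    using c by (auto simp: bij_betw_def)
  note walk = awalk_of_sequence[of c k, OF this arcs]
  have "apath (c 0) ?p (c k)"
    unfolding apath_def using walk c
    by (simp add: distinct_map bij_betw_def atLeast0LessThan del: upt_Suc)
  moreover have "set (pawalk_verts (c 0) ?p) = pverts G"
    using walk(2) c by (simp add: bij_betw_def atLeast0LessThan del: upt_Suc)
  ultimately show ?thesis
    unfolding traceable_def by auto
qed

lemma hamiltonian_if_enumeration:
  assumes c: "bij_betw c {..<k} (pverts G)" and "3 \<le> k"
    and arcs: "\<And>i. i < k \<Longrightarrow> (c i, c (Suc i mod k)) \<in> parcs G"
  shows "hamiltonian G"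
proof -
  define c' where "c' i = c (i mod k)" for i
  let ?p = "map (\<lambda>i. (c' i, c' (Suc i))) [0..<k]"
  have "c' 0 \<in> pverts G"
    using c assms(2) by (auto simp: bij_betw_def c'_def)
  moreover have "(c' i, c' (Suc i)) \<in> parcs G" if "i < k" for i
    using arcs[OF that] that by (simp add: c'_def)
  ultimately have walk: "awalk (c' 0) ?p (c' k)" "pawalk_verts (c' 0) ?p = map c' [0..<Suc k]"
    using awalk_of_sequence[of c' k] by auto
  have img: "c' ` {..<k} = pverts G" and inj: "inj_on c' {..<k}"
    using c by (auto simp: bij_betw_def inj_on_def c'_def)
  have "distinct (map c' [1..<Suc k])"
  proof -
    have "inj_on c' {1..<k}"
      using inj by (rule inj_on_subset) auto
    moreover have "c' k \<notin> c' ` {1..<k}"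
    proof
      assume "c' k \<in> c' ` {1..<k}"
      then obtain i where "1 \<le> i" "i < k" "c' 0 = c' i"
        by (auto simp: c'_def)
      then show False
        using inj by (auto simp: inj_on_def)
    qed
    ultimately show ?thesis
      using assms(2) by (simp add: distinct_map)
  qed
  then have "distinct (tl (pawalk_verts (c' 0) ?p))"
    unfolding walk(2) by (simp add: upt_conv_Cons del: upt_Suc)
  moreover have "c' k = c' 0"
    by (simp add: c'_def)
  ultimately have "cycle ?p"
    using walk(1) assms(2) unfolding cycle_def by auto
  moreover have "fst ` set ?p = pverts G"
    using img by (simp add: image_image atLeast0LessThan)
  ultimately show ?thesis
    unfolding hamiltonian_def using assms(2) by (intro exI[of _ ?p]) simp
qed

end

text \<open>
  Isomorphisms of directed multigraphs carry a separate map on arcs. When arcs are pairs of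
  vertices, that map is determined by the map on vertices.
\<close>

lemma digraph_iso_if_bij_betw:
  assumes "pair_wf_digraph G" and "pair_wf_digraph H"
    and f: "bij_betw f (pverts G) (pverts H)"
    and arcs: "\<And>x y. x \<in> pverts G \<Longrightarrow> y \<in> pverts G \<Longrightarrow>
      (f x, f y) \<in> parcs H \<longleftrightarrow> (x, y) \<in> parcs G"
  shows "digraph_iso (with_proj G) (with_proj H)"
proof -
  interpret G: pair_wf_digraph G by fact
  interpret H: pair_wf_digraph H by fact
  let ?h = "\<lparr> iso_verts = f, iso_arcs = map_prod f f, iso_head = snd, iso_tail = fst \<rparr>"
  have inj: "inj_on f (pverts G)" and img: "f ` pverts G = pverts H"
    using f by (auto simp: bij_betw_def)
  have "inj_on (map_prod f f) (pverts G \<times> pverts G)"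
    using inj by (auto simp: inj_on_def)
  moreover have "parcs G \<subseteq> pverts G \<times> pverts G"
    using G.in_arcsD1 G.in_arcsD2 by auto
  ultimately have "inj_on (map_prod f f) (parcs G)"
    by (rule inj_on_subset)
  then have "G.digraph_isomorphism ?h"
    unfolding G.digraph_isomorphism_def using inj G.wf_digraph by simp
  moreover have "map_prod f f ` parcs G = parcs H"
  proof (intro equalityI subsetI)
    fix e assume "e \<in> map_prod f f ` parcs G"
    then show "e \<in> parcs H"
      using arcs G.in_arcsD1 G.in_arcsD2 by auto
  next
    fix e assume e: "e \<in> parcs H"
    then have "fst e \<in> f ` pverts G" "snd e \<in> f ` pverts G"
      using H.arc_fst_in_verts H.arc_snd_in_verts img by auto
    then obtain x y where "x \<in> pverts G" "y \<in> pverts G" "e = (f x, f y)"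
      by (metis imageE prod.collapse)
    then show "e \<in> map_prod f f ` parcs G"
      using e arcs by (intro image_eqI[of _ _ "(x, y)"]) auto
  qed
  then have "with_proj H = app_iso ?h (with_proj G)"
    using img by (simp add: app_iso_def with_proj_def)
  ultimately show ?thesis
    unfolding digraph_iso_def by blast
qed

section \<open>Bipartite graphs\<close>

locale bipartite_pair_graph = pair_graph +
  fixes V1 V2 :: "'a set"
  assumes parts: "bipartite_with_parts G V1 V2"
begin

lemma parts_commute: "bipartite_pair_graph G V2 V1"
  using parts by unfold_locales (auto simp: bipartite_with_parts_def)

lemma parts_disjoint: "V1 \<inter> V2 = {}"
  and parts_Un: "V1 \<union> V2 = pverts G"
  and parts_nonempty: "V1 \<noteq> {}" "V2 \<noteq> {}"
  using parts by (auto simp: bipartite_with_parts_def)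

lemma finite_parts [simp]: "finite V1" "finite V2"
  using parts_Un pair_finite_verts by (metis finite_Un)+

lemma parcs_sym: "(u, v) \<in> parcs G \<longleftrightarrow> (v, u) \<in> parcs G"
  using pair_sym_arcs by (auto simp: symmetric_def sym_def)

lemma no_arc_in_part:
  "u \<in> V1 \<Longrightarrow> v \<in> V1 \<Longrightarrow> (u, v) \<notin> parcs G"
  "u \<in> V2 \<Longrightarrow> v \<in> V2 \<Longrightarrow> (u, v) \<notin> parcs G"
  using parts by (auto simp: bipartite_with_parts_def independent_set_def)

lemma neighbours_subset: "u \<in> V1 \<Longrightarrow> parcs G `` {u} \<subseteq> V2"
  using no_arc_in_part(1) parts_Un in_arcsD2 by blast

lemma out_degree_eq_card_neighbours: "out_degree (with_proj G) u = card (parcs G `` {u})"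
proof -
  have "out_arcs (with_proj G) u = Pair u ` (parcs G `` {u})"
    by (auto simp: out_arcs_def)
  then show ?thesis
    by (simp add: out_degree_def card_image inj_on_def)
qed

lemma out_degree_le_card_part: "u \<in> V1 \<Longrightarrow> out_degree (with_proj G) u \<le> card V2"
  by (simp add: out_degree_eq_card_neighbours card_mono neighbours_subset)

lemma adjacent_if_full_degree:
  assumes "u \<in> V1" and "v \<in> V2" and "out_degree (with_proj G) u = card V2"
  shows "(u, v) \<in> parcs G"
proof -
  have "parcs G `` {u} = V2"
    using assms neighbours_subset
    by (intro card_subset_eq) (auto simp: out_degree_eq_card_neighbours)
  then show ?thesis
    using assms(2) by auto
qed

text \<open>Both sums count the edges, since every edge has one end in each part.\<close>

lemma sum_out_degree_parts:
  "(\<Sum>u\<in>V1. out_degree (with_proj G) u) = (\<Sum>v\<in>V2. out_degree (with_proj G) v)"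
proof -
  interpret swapped: bipartite_pair_graph G V2 V1
    by (rule parts_commute)
  have fin: "finite (parcs G `` {u})" for u
    using pair_finite_arcs by (rule finite_Image)
  have "(SIGMA v:V2. parcs G `` {v}) = prod.swap ` (SIGMA u:V1. parcs G `` {u})"
  proof (intro equalityI subsetI)
    fix e assume "e \<in> (SIGMA v:V2. parcs G `` {v})"
    then obtain v u where e: "e = (v, u)" "v \<in> V2" "(v, u) \<in> parcs G"
      by auto
    then have "u \<in> V1"
      using swapped.neighbours_subset by auto
    then show "e \<in> prod.swap ` (SIGMA u:V1. parcs G `` {u})"
      using e parcs_sym by (intro image_eqI[of _ _ "(u, v)"]) auto
  next
    fix e assume "e \<in> prod.swap ` (SIGMA u:V1. parcs G `` {u})"
    then obtain v u where e: "e = (v, u)" "u \<in> V1" "(u, v) \<in> parcs G"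
      by auto
    then show "e \<in> (SIGMA v:V2. parcs G `` {v})"
      using neighbours_subset parcs_sym by auto
  qed
  then have "card (SIGMA v:V2. parcs G `` {v}) = card (SIGMA u:V1. parcs G `` {u})"
    by (simp add: card_image)
  then show ?thesis
    by (simp add: out_degree_eq_card_neighbours fin)
qed

lemma hamiltonian_if_alternating:
  assumes x: "bij_betw x {..<n} V1" and y: "bij_betw y {..<n} V2" and "2 \<le> n"
    and xy: "\<And>i. i < n \<Longrightarrow> (x i, y i) \<in> parcs G"
    and yx: "\<And>i. i < n \<Longrightarrow> (y i, x (Suc i mod n)) \<in> parcs G"
  shows "hamiltonian G"
proof (rule hamiltonian_if_enumeration)
  show "bij_betw (interleave x y) {..<n + n} (pverts G)"
    using bij_betw_interleave[OF x y parts_disjoint] by (simp add: parts_Un)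
  show "3 \<le> n + n"
    using assms(3) by simp
  fix a assume a: "a < n + n"
  obtain i where "a = 2 * i \<or> a = Suc (2 * i)"
    by (metis evenE oddE Suc_eq_plus1)
  then show "(interleave x y a, interleave x y (Suc a mod (n + n))) \<in> parcs G"
  proof
    assume "a = 2 * i"
    moreover from this have "i < n"
      using a by linarith
    ultimately show ?thesis
      using xy by simp
  next
    assume ai: "a = Suc (2 * i)"
    then have "Suc a mod (n + n) = 2 * (Suc i mod n)"
      by (simp add: mult_2[symmetric] mult_mod_right)
    then show ?thesis
      using yx[of i] ai a by simp
  qed
qed

lemma traceable_if_alternating:
  assumes x: "bij_betw x {..<n} V1" and y: "bij_betw y {..<Suc n} V2"
    and yx: "\<And>i. i < n \<Longrightarrow> (y i, x i) \<in> parcs G"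
    and xy: "\<And>i. i < n \<Longrightarrow> (x i, y (Suc i)) \<in> parcs G"
  shows "traceable G"
proof (rule traceable_if_enumeration)
  show "bij_betw (interleave y x) {..<Suc (n + n)} (pverts G)"
    using bij_betw_interleave[OF y x] parts_disjoint parts_Un by (simp add: Un_commute Int_commute)
  fix a assume a: "a < n + n"
  obtain i where "a = 2 * i \<or> a = Suc (2 * i)"
    by (metis evenE oddE Suc_eq_plus1)
  moreover from this have "i < n"
    using a by linarith
  ultimately show "(interleave y x a, interleave y x (Suc a)) \<in> parcs G"
    using xy yx by auto
qed

section \<open>Complete bipartite graphs minus a matching\<close>

text \<open>
  Numberings that exhibit \<open>G\<close> as a complete bipartite graph minus the matching of the pairs
  \<open>u i, v i\<close>. For \<open>m = n\<close> this is the crown graph; for \<open>n = m + 1\<close> it is a crown graph with one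
  vertex deleted.
\<close>

definition crown_enumeration :: "nat \<Rightarrow> nat \<Rightarrow> (nat \<Rightarrow> 'a) \<Rightarrow> (nat \<Rightarrow> 'a) \<Rightarrow> bool" where
  "crown_enumeration m n u v \<longleftrightarrow> bij_betw u {..<m} V1 \<and> bij_betw v {..<n} V2 \<and>
     (\<forall>i<m. \<forall>j<n. (u i, v j) \<in> parcs G \<longleftrightarrow> i \<noteq> j)"

text \<open>
  Every vertex of \<open>V1\<close> has a unique non-neighbour in \<open>V2\<close>. The map \<open>\<sigma>\<close> to this non-neighbour is
  injective by the degree bound on \<open>V2\<close>, so its graph is the missing matching.
\<close>

lemma ex_crown_enumeration:
  assumes degV1: "\<And>u. u \<in> V1 \<Longrightarrow> out_degree (with_proj G) u = card V2 - 1"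
    and degV2: "\<And>v. v \<in> V2 \<Longrightarrow> card V1 - 1 \<le> out_degree (with_proj G) v"
  shows "\<exists>u v. crown_enumeration (card V1) (card V2) u v"
proof -
  interpret swapped: bipartite_pair_graph G V2 V1
    by (rule parts_commute)
  have "\<exists>v. V2 - parcs G `` {u} = {v}" if "u \<in> V1" for u
  proof -
    have "card V2 > 0"
      using parts_nonempty by (simp add: card_gt_0_iff)
    then have "card (V2 - parcs G `` {u}) = 1"
      using degV1[OF that] neighbours_subset[OF that]
      by (simp add: card_Diff_subset out_degree_eq_card_neighbours finite_subset)
    then show ?thesis
      by (auto simp: card_1_singleton_iff)
  qed
  then obtain \<sigma> where \<sigma>: "\<And>u. u \<in> V1 \<Longrightarrow> V2 - parcs G `` {u} = {\<sigma> u}"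
    by metis
  have inj: "inj_on \<sigma> V1"
  proof (rule inj_onI, rule ccontr)
    fix u u' assume u: "u \<in> V1" "u' \<in> V1" "\<sigma> u = \<sigma> u'" "u \<noteq> u'"
    then have v: "\<sigma> u \<in> V2" "(u, \<sigma> u) \<notin> parcs G" "(u', \<sigma> u) \<notin> parcs G"
      using \<sigma>[of u] \<sigma>[of u'] by auto
    then have "parcs G `` {\<sigma> u} \<subseteq> V1 - {u, u'}"
      using swapped.neighbours_subset[of "\<sigma> u"] parcs_sym by blast
    then have "out_degree (with_proj G) (\<sigma> u) \<le> card (V1 - {u, u'})"
      by (simp add: out_degree_eq_card_neighbours card_mono)
    moreover have "card (V1 - {u, u'}) = card V1 - 2" and "2 \<le> card V1"
      using u card_mono[of V1 "{u, u'}"] by (auto simp: card_Diff_subset)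
    ultimately show False
      using degV2[OF v(1)] by linarith
  qed
  have "\<sigma> ` V1 \<subseteq> V2"
    using \<sigma> by auto
  then obtain v where v: "bij_betw v {..<card V2} V2" "v ` {..<card (\<sigma> ` V1)} = \<sigma> ` V1"
    using ex_enumeration_extending_subset[of V2 "\<sigma> ` V1"] by auto
  have card_img: "card (\<sigma> ` V1) = card V1"
    using inj by (rule card_image)
  have le: "card V1 \<le> card V2"
    using \<open>\<sigma> ` V1 \<subseteq> V2\<close> card_mono[of V2 "\<sigma> ` V1"] by (simp add: card_img)
  define u where "u = inv_into V1 \<sigma> \<circ> v"
  have "bij_betw v {..<card V1} (\<sigma> ` V1)"
    using v le unfolding card_img by (auto simp: bij_betw_def intro: inj_on_subset)
  moreover have "bij_betw (inv_into V1 \<sigma>) (\<sigma> ` V1) V1"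
    using inj by (intro bij_betw_inv_into) (simp add: bij_betw_def)
  ultimately have u: "bij_betw u {..<card V1} V1"
    unfolding u_def by (rule bij_betw_trans)
  have "(u i, v j) \<in> parcs G \<longleftrightarrow> i \<noteq> j" if "i < card V1" "j < card V2" for i j
  proof -
    have ui: "u i \<in> V1" and vj: "v j \<in> V2"
      using u v(1) that by (auto simp: bij_betw_def)
    have "v i \<in> \<sigma> ` V1"
      using v(2) that(1) unfolding card_img by auto
    then have "\<sigma> (u i) = v i"
      by (simp add: u_def f_inv_into_f)
    then have "(u i, v j) \<in> parcs G \<longleftrightarrow> v j \<noteq> v i"
      using \<sigma>[OF ui] vj by auto
    also have "\<dots> \<longleftrightarrow> i \<noteq> j"
      using v(1) that le by (auto simp: bij_betw_def inj_on_def)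
    finally show ?thesis .
  qed
  then show ?thesis
    unfolding crown_enumeration_def using u v(1) by blast
qed

text \<open>
  In the cyclic order \<open>\<dots>, v (i + 1), u i, v (i + 2), u (i + 1), \<dots>\<close> the vertex \<open>u i\<close> avoids
  its non-neighbour \<open>v i\<close>, because \<open>i\<close>, \<open>i + 1\<close> and \<open>i + 2\<close> are distinct modulo \<open>n\<close>.
\<close>

lemma hamiltonian_if_crown:
  assumes "crown_enumeration n n u v" and "3 \<le> n"
  shows "hamiltonian G"
proof (rule hamiltonian_if_alternating)
  let ?y = "\<lambda>i. v ((i + 2) mod n)"
  have u: "bij_betw u {..<n} V1" and v: "bij_betw v {..<n} V2"
    using assms(1) by (auto simp: crown_enumeration_def)
  have adj: "(u i, v j) \<in> parcs G \<longleftrightarrow> i \<noteq> j" if "i < n" "j < n" for i j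
    using assms(1) that by (auto simp: crown_enumeration_def)
  show "bij_betw u {..<n} V1" by (rule u)
  show "bij_betw ?y {..<n} V2"
    using bij_betw_trans[OF bij_betw_shift_mod[of n 2] v] assms(2) by (simp add: comp_def)
  show "2 \<le> n" using assms(2) by simp
  fix i assume i: "i < n"
  show "(u i, ?y i) \<in> parcs G"
    using shift_mod_neq[of 2 n i] i assms(2) by (subst adj) auto
  have "(u (Suc i mod n), ?y i) \<in> parcs G"
    using shift_mod_neq[of 1 n "Suc i"] i assms(2) by (subst adj) auto
  then show "(?y i, u (Suc i mod n)) \<in> parcs G"
    using parcs_sym by blast
qed

text \<open>
  The cyclic order of \<open>hamiltonian_if_crown\<close> for \<open>Suc n\<close>, cut open at the vertex \<open>u n\<close>, which is
  absent here: the path runs from \<open>v 1\<close> to \<open>v 0\<close>.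
\<close>

lemma traceable_if_crown:
  assumes "crown_enumeration n (Suc n) u v" and "2 \<le> n"
  shows "traceable G"
proof (rule traceable_if_alternating)
  let ?y = "\<lambda>i. v ((i + 1) mod Suc n)"
  have u: "bij_betw u {..<n} V1" and v: "bij_betw v {..<Suc n} V2"
    using assms(1) by (auto simp: crown_enumeration_def)
  have adj: "(u i, v j) \<in> parcs G \<longleftrightarrow> i \<noteq> j" if "i < n" "j < Suc n" for i j
    using assms(1) that by (auto simp: crown_enumeration_def)
  show "bij_betw u {..<n} V1" by (rule u)
  show "bij_betw ?y {..<Suc n} V2"
    using bij_betw_trans[OF bij_betw_shift_mod[of "Suc n" 1] v] by (simp add: comp_def)
  fix i assume i: "i < n"
  have "(u i, ?y i) \<in> parcs G"
    using shift_mod_neq[of 1 "Suc n" i] i assms(2) by (subst adj) auto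
  then show "(?y i, u i) \<in> parcs G"
    using parcs_sym by blast
  show "(u i, ?y (Suc i)) \<in> parcs G"
    using shift_mod_neq[of 2 "Suc n" i] i assms(2) by (subst adj) auto
qed

text \<open>
  The edges are \<open>u i, v j\<close> with \<open>i \<noteq> j\<close>; for \<open>n \<le> 2\<close> these are at most the two disjoint edges
  \<open>u 0, v 1\<close> and \<open>u 1, v 0\<close>.
\<close>

lemma digraph_iso_if_small_crown:
  assumes "crown_enumeration m n u v" and "0 < m" and "m \<le> n" and "n \<le> 2"
  shows "digraph_iso (with_proj G) (with_proj (disjoint_cliques m n))"
proof -
  have u: "bij_betw u {..<m} V1" and v: "bij_betw v {..<n} V2"
    using assms(1) by (auto simp: crown_enumeration_def)
  have adj: "(u i, v j) \<in> parcs G \<longleftrightarrow> i \<noteq> j" if "i < m" "j < n" for i j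
    using assms(1) that by (auto simp: crown_enumeration_def)
  have adj': "(v j, u i) \<in> parcs G \<longleftrightarrow> i \<noteq> j" if "i < m" "j < n" for i j
    using adj[OF that] parcs_sym by blast
  have uV: "u i \<in> V1" if "i < m" for i
    using u that by (auto simp: bij_betw_def)
  have vV: "v i \<in> V2" if "i < n" for i
    using v that by (auto simp: bij_betw_def)
  have uu: "(u i, u j) \<notin> parcs G" if "i < m" "j < m" for i j
    using no_arc_in_part(1)[OF uV uV] that by simp
  have vv: "(v i, v j) \<notin> parcs G" if "i < n" "j < n" for i j
    using no_arc_in_part(2)[OF vV vV] that by simp
  have uv: "u i \<noteq> v j" if "i < m" "j < n" for i j
    using uV[OF that(1)] vV[OF that(2)] parts_disjoint by auto
  have inj: "inj_on u {..<m}" "inj_on v {..<n}"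
    using u v by (simp_all add: bij_betw_def)
  have pv: "pverts G = u ` {..<m} \<union> v ` {..<n}"
    using u v parts_Un by (simp add: bij_betw_def)
  \<comment> \<open>The second clique is \<open>{u 0, v 1}\<close> and the first is \<open>{v 0, u 1}\<close>, each cut down to the
      vertices that exist.\<close>
  define g where "g x = (case x of Inl i \<Rightarrow> if i = 0 then v 0 else u 1
      | Inr i \<Rightarrow> if i = 0 then u 0 else v 1)" for x :: "nat + nat"
  have cases: "m = 1 \<and> n = 1 \<or> m = 1 \<and> n = 2 \<or> m = 2 \<and> n = 2"
    using assms(2-4) by linarith
  have "bij_betw g (pverts (disjoint_cliques m n)) (pverts G) \<and>
    (\<forall>x\<in>pverts (disjoint_cliques m n). \<forall>y\<in>pverts (disjoint_cliques m n).
      (g x, g y) \<in> parcs G \<longleftrightarrow> (x, y) \<in> parcs (disjoint_cliques m n))"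
    using cases
  proof (elim disjE conjE)
    assume mn: "m = 1" "n = 1"
    have "pverts (disjoint_cliques m n) = {Inl 0, Inr 0}" and "pverts G = {u 0, v 0}"
      using mn by (auto simp: disjoint_cliques_def pv lessThan_Suc)
    moreover have "u 0 \<noteq> v 0"
      using uv mn by simp
    ultimately show ?thesis
      using mn by (auto simp: bij_betw_def g_def disjoint_cliques_def uu vv adj adj')
  next
    assume mn: "m = 1" "n = 2"
    have "pverts (disjoint_cliques m n) = {Inl 0, Inr 0, Inr 1}" and "pverts G = {u 0, v 0, v 1}"
      using mn by (auto simp: disjoint_cliques_def pv lessThan_Suc numeral_2_eq_2)
    moreover have "u 0 \<noteq> v 0" "u 0 \<noteq> v 1" "v 0 \<noteq> v 1"
      using uv mn inj_onD[OF inj(1), of 0 1] inj_onD[OF inj(2), of 0 1] by auto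
    ultimately show ?thesis
      using mn by (auto simp: bij_betw_def g_def disjoint_cliques_def uu vv adj adj')
  next
    assume mn: "m = 2" "n = 2"
    have "pverts (disjoint_cliques m n) = {Inl 0, Inl 1, Inr 0, Inr 1}"
      and "pverts G = {u 0, u 1, v 0, v 1}"
      using mn by (auto simp: disjoint_cliques_def pv lessThan_Suc numeral_2_eq_2)
    moreover have "u 0 \<noteq> v 0" "u 0 \<noteq> v 1" "u 1 \<noteq> v 0" "u 1 \<noteq> v 1" "u 0 \<noteq> u 1" "v 0 \<noteq> v 1"
      using uv mn inj_onD[OF inj(1), of 0 1] inj_onD[OF inj(2), of 0 1] by auto
    ultimately show ?thesis
      using mn by (auto simp: bij_betw_def g_def disjoint_cliques_def uu vv adj adj')
  qed
  then have bij: "bij_betw g (pverts (disjoint_cliques m n)) (pverts G)"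
    and arcs: "\<And>x y. x \<in> pverts (disjoint_cliques m n) \<Longrightarrow> y \<in> pverts (disjoint_cliques m n) \<Longrightarrow>
      (g x, g y) \<in> parcs G \<longleftrightarrow> (x, y) \<in> parcs (disjoint_cliques m n)"
    by blast+
  interpret H: pair_graph "disjoint_cliques m n"
    by (rule pair_graph_disjoint_cliques)
  have "digraph_iso (with_proj (disjoint_cliques m n)) (with_proj G)"
    by (rule digraph_iso_if_bij_betw[OF _ _ bij arcs]) unfold_locales
  then show ?thesis
    by (rule digraph_iso_swap[OF H.wf_digraph])
qed

end

section \<open>Bipartite graphs with the degree sequence of two cliques\<close>

locale bipartite_clique_degrees = bipartite_pair_graph +
  fixes m n :: nat
  assumes m_pos: "0 < m" and m_le_n: "m \<le> n"
    and degrees: "degree_sequence G = replicate_mset m (m - 1) + replicate_mset n (n - 1)"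
begin

lemma swapped_parts: "bipartite_clique_degrees G V2 V1 m n"
  using m_pos m_le_n degrees parts_commute
  by (simp add: bipartite_clique_degrees_def bipartite_clique_degrees_axioms_def)

abbreviation deg :: "'a \<Rightarrow> nat" where
  "deg u \<equiv> out_degree (with_proj G) u"

definition high :: "'a set" where
  "high = {u \<in> pverts G. deg u = n - 1}"

lemma finite_high [simp]: "finite high"
  using pair_finite_verts by (simp add: high_def)

lemma card_parts: "card V1 + card V2 = m + n"
proof -
  have "size (degree_sequence G) = card (pverts G)"
    by (simp add: degree_sequence_def)
  then have "card (pverts G) = m + n"
    by (simp add: degrees)
  then show ?thesis
    using card_Un_disjoint[OF finite_parts parts_disjoint] by (simp add: parts_Un)
qed

lemma deg_cases:
  assumes "u \<in> pverts G"
  shows "deg u = m - 1 \<or> deg u = n - 1"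
proof -
  have "deg u \<in># degree_sequence G"
    using assms pair_finite_verts by (simp add: degree_sequence_def)
  then show ?thesis
    by (auto simp: degrees split: if_splits)
qed

lemma card_high:
  assumes "m < n"
  shows "card (V1 \<inter> high) + card (V2 \<inter> high) = n"
proof -
  have "count (degree_sequence G) (n - 1) = n"
    using assms m_pos by (simp add: degrees)
  moreover have "count (degree_sequence G) (n - 1) = card high"
    using pair_finite_verts
    by (simp add: degree_sequence_def count_image_mset high_def vimage_def Collect_conj_eq
        Int_commute)
  moreover have "card high = card (V1 \<inter> high) + card (V2 \<inter> high)"
  proof -
    have "high = (V1 \<inter> high) \<union> (V2 \<inter> high)"
      using parts_Un by (auto simp: high_def)
    then show ?thesis
      using parts_disjoint card_Un_disjoint[of "V1 \<inter> high" "V2 \<inter> high"] by auto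
  qed
  ultimately show ?thesis
    by simp
qed

lemma sum_deg_part:
  "(\<Sum>u\<in>V1. deg u) = card V1 * (m - 1) + card (V1 \<inter> high) * (n - m)"
proof -
  have "deg u = (m - 1) + (if u \<in> high then n - m else 0)" if "u \<in> V1" for u
    using that parts_Un deg_cases[of u] m_pos m_le_n by (auto simp: high_def)
  then have "(\<Sum>u\<in>V1. deg u) = (\<Sum>u\<in>V1. (m - 1) + (if u \<in> high then n - m else 0))"
    by (rule sum.cong[OF refl])
  also have "\<dots> = card V1 * (m - 1) + card (V1 \<inter> high) * (n - m)"
    by (simp add: sum.distrib sum.inter_restrict[symmetric])
  finally show ?thesis .
qed

lemma edge_count:
  "card V1 * (m - 1) + card (V1 \<inter> high) * (n - m) =
   card V2 * (m - 1) + card (V2 \<inter> high) * (n - m)"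
proof -
  interpret swapped: bipartite_clique_degrees G V2 V1 m n
    by (rule swapped_parts)
  show ?thesis
    using sum_out_degree_parts by (simp add: sum_deg_part swapped.sum_deg_part)
qed

lemma high_part_bound:
  assumes "V1 \<inter> high \<noteq> {}"
  shows "n - 1 \<le> card V2"
proof -
  obtain u where "u \<in> V1" and "deg u = n - 1"
    using assms by (auto simp: high_def)
  then show ?thesis
    using out_degree_le_card_part[of u] by simp
qed

text \<open>
  High vertices force the opposite part to be large. Since \<open>V2\<close> has one, \<open>V1\<close> and therefore also
  \<open>V2\<close> has at least \<open>n - 1\<close> of the \<open>m + n\<close> vertices.
\<close>

lemma part_sizes_if_less:
  assumes "m < n" and "card V1 \<le> card V2"
  shows "(card V1 = m + 1 \<and> card V2 = m + 1 \<and> n = m + 2) \<or>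
         (card V1 = m \<and> card V2 = n \<and> n = m + 1)"
proof -
  interpret swapped: bipartite_clique_degrees G V2 V1 m n
    by (rule swapped_parts)
  have le1: "card (V1 \<inter> high) \<le> card V1"
    by (simp add: card_mono)
  have "V2 \<inter> high \<noteq> {}"
  proof
    assume "V2 \<inter> high = {}"
    then have "n \<le> card V1"
      using card_high[OF assms(1)] le1 by simp
    then show False
      using assms card_parts by linarith
  qed
  then have "n - 1 \<le> card V1"
    by (rule swapped.high_part_bound)
  then show ?thesis
    using assms card_parts by linarith
qed

lemma parts_eq_if_eq:
  assumes "m = n"
  shows "card V1 = n" and "card V2 = n"
proof -
  have "card V1 > 0" "card V2 > 0"
    using parts_nonempty by (simp_all add: card_gt_0_iff)
  moreover have "card V1 * (n - 1) = card V2 * (n - 1)"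
    using edge_count assms by simp
  ultimately show "card V1 = n" and "card V2 = n"
    using card_parts assms by (cases "n = 1"; auto)+
qed

text \<open>The graph is a crown graph; the second alternative is that of \<open>n \<le> 2\<close>.\<close>

lemma hamiltonian_or_clique_pair_if_eq:
  assumes "m = n"
  shows "hamiltonian G \<or> digraph_iso (with_proj G) (with_proj (disjoint_cliques m n))"
proof -
  have "deg u = n - 1" if "u \<in> pverts G" for u
    using deg_cases[OF that] assms by simp
  then obtain u v where crown: "crown_enumeration n n u v"
    using ex_crown_enumeration parts_eq_if_eq[OF assms] parts_Un by (metis Un_iff order_refl)
  show ?thesis
  proof (cases "3 \<le> n")
    case True
    then show ?thesis
      using hamiltonian_if_crown[OF crown] by simp
  next
    case False
    then show ?thesis
      using digraph_iso_if_small_crown[of m n u v] crown m_pos assms by auto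
  qed
qed

text \<open>
  The edge count puts \<open>m\<close> of the \<open>m + 1\<close> high vertices into \<open>V1\<close>, that is, all of \<open>V1\<close> is high,
  so every vertex of \<open>V1\<close> misses exactly one of \<open>V2\<close>. The second alternative is that of \<open>m = 1\<close>.
\<close>

lemma traceable_or_clique_pair_if_Suc:
  assumes "card V1 = m" and "card V2 = n" and "n = m + 1"
  shows "traceable G \<or> digraph_iso (with_proj G) (with_proj (disjoint_cliques m n))"
proof -
  have "card (V1 \<inter> high) + card (V2 \<inter> high) = m + 1"
    using card_high assms(3) by simp
  moreover have "m * (m - 1) + card (V1 \<inter> high) = m * (m - 1) + (m - 1) + card (V2 \<inter> high)"
    using edge_count assms by simp
  ultimately have "card (V1 \<inter> high) = card V1"
    using m_pos assms(1) by linarith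
  then have "V1 \<inter> high = V1"
    by (intro card_subset_eq) auto
  then have degV1: "deg u = card V2 - 1" if "u \<in> V1" for u
    using that assms(2) by (auto simp: high_def)
  have degV2: "card V1 - 1 \<le> deg v" if "v \<in> V2" for v
  proof -
    have "v \<in> pverts G"
      using that parts_Un by auto
    then show ?thesis
      using deg_cases assms by fastforce
  qed
  obtain u v where crown: "crown_enumeration m n u v"
    using ex_crown_enumeration[OF degV1 degV2] assms by auto
  show ?thesis
  proof (cases "2 \<le> m")
    case True
    then show ?thesis
      using traceable_if_crown[of m u v] crown assms(3) by simp
  next
    case False
    then show ?thesis
      using digraph_iso_if_small_crown[OF crown] m_pos assms(3) by simp
  qed
qed

lemma half_high_if_equal_parts:
  assumes "m < n" and "card V1 = card V2"
  shows "2 * card (V1 \<inter> high) = n" and "2 * card (V2 \<inter> high) = n"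
proof -
  have "card (V1 \<inter> high) = card (V2 \<inter> high)"
    using edge_count assms by simp
  then show "2 * card (V1 \<inter> high) = n" and "2 * card (V2 \<inter> high) = n"
    using card_high[OF assms(1)] by linarith+
qed

text \<open>
  Here \<open>n - 1 = m + 1\<close> is the size of each part, so high vertices are adjacent to the whole opposite
  part. With \<open>m = 2 k\<close>, list \<open>V1\<close> as \<open>x 0, \<dots>, x m\<close> with its \<open>k + 1\<close> high vertices first, and
  \<open>V2\<close> as \<open>y 0, \<dots>, y m\<close> with its \<open>k\<close> other vertices first. Then \<open>x i\<close> is high for \<open>i \<le> k\<close> and
  \<open>y i\<close> is high for \<open>i \<ge> k\<close>, so in the cyclic order \<open>x 0, y 0, x 1, y 1, \<dots>, x m, y m\<close> one of
  any two consecutive vertices is high.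
\<close>

lemma hamiltonian_if_add_2:
  assumes "card V1 = card V2" and "n = m + 2"
  shows "hamiltonian G"
proof -
  interpret swapped: bipartite_clique_degrees G V2 V1 m n
    by (rule swapped_parts)
  have sizes: "card V1 = Suc m" "card V2 = Suc m"
    using card_parts assms by linarith+
  define k where "k = card (V2 - high)"
  have high1: "card (V1 \<inter> high) = Suc k" and mk: "m = 2 * k"
  proof -
    have "card (V2 - high) = card V2 - card (V2 \<inter> high)"
      by (simp add: card_Diff_subset_Int)
    then show "card (V1 \<inter> high) = Suc k" and "m = 2 * k"
      using half_high_if_equal_parts assms sizes by (auto simp: k_def)
  qed
  obtain x where x: "bij_betw x {..<Suc m} V1" "x ` {..<Suc k} = V1 \<inter> high"
    using ex_enumeration_extending_subset[of V1 "V1 \<inter> high"] sizes high1 by auto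
  obtain y where y: "bij_betw y {..<Suc m} V2" "y ` {..<k} = V2 - high"
    using ex_enumeration_extending_subset[of V2 "V2 - high"] sizes by (auto simp: k_def)
  have xV: "x i \<in> V1" and yV: "y i \<in> V2" if "i < Suc m" for i
    using that x(1) y(1) by (auto simp: bij_betw_def)
  have y_high: "y i \<in> high" if "k \<le> i" "i < Suc m" for i
  proof (rule ccontr)
    assume "y i \<notin> high"
    then have "y i \<in> y ` {..<k}"
      using yV[OF that(2)] y(2) by auto
    then obtain j where "j < k" "y i = y j"
      by auto
    moreover have "inj_on y {..<Suc m}"
      using y(1) by (rule bij_betw_imp_inj_on)
    ultimately show False
      using that inj_onD[of y "{..<Suc m}" i j] by simp
  qed
  have adj: "(x i, y j) \<in> parcs G" if "i < Suc m" "j < Suc m" "i \<le> k \<or> k \<le> j" for i j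
    using that(3)
  proof
    assume "i \<le> k"
    then have "x i \<in> high"
      using x(2) by auto
    then have "deg (x i) = n - 1"
      by (simp add: high_def)
    then show ?thesis
      using adjacent_if_full_degree[OF xV yV] that(1,2) sizes assms(2) by simp
  next
    assume "k \<le> j"
    then have "deg (y j) = n - 1"
      using y_high that(2) by (simp add: high_def)
    then have "(y j, x i) \<in> parcs G"
      using swapped.adjacent_if_full_degree[OF yV xV] that(1,2) sizes assms(2)
      by simp
    then show ?thesis
      using parcs_sym by blast
  qed
  show ?thesis
  proof (rule hamiltonian_if_alternating[OF x(1) y(1)])
    show "2 \<le> Suc m"
      using m_pos by simp
    fix i assume i: "i < Suc m"
    show "(x i, y i) \<in> parcs G"
      by (rule adj[OF i i]) linarith
    have "(x (Suc i mod Suc m), y i) \<in> parcs G"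
    proof (cases "i = m")
      case True
      \<comment> \<open>The closing edge: \<open>x 0\<close> is high.\<close>
      then show ?thesis
        using adj[of 0 i] by simp
    next
      case False
      moreover have "Suc i \<le> k \<or> k \<le> i"
        by linarith
      ultimately show ?thesis
        using adj[of "Suc i" i] i by simp
    qed
    then show "(y i, x (Suc i mod Suc m)) \<in> parcs G"
      using parcs_sym by blast
  qed
qed

end

theorem theorem9:
  fixes G :: "'a pair_pre_digraph" and V1 V2 :: "'a set" and m n :: nat
  assumes "0 < m" and "0 < n" and "m \<le> n"
    and "G \<in> clique_pair_class m n"
    and "bipartite_with_parts G V1 V2"
    and "card V1 \<le> card V2"
  shows "((card V1 = card V2 \<and> n = m + 2 \<and> even m \<and> even n) \<or>
          (card V1 = m \<and> card V2 = n \<and> n = m + 1) \<or>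
          (card V1 = card V2 \<and> m = n)) \<and>
         (card V1 = card V2 \<and> n = m + 2 \<and> even m \<and> even n \<longrightarrow> hamiltonian G) \<and>
         (card V1 = m \<and> card V2 = n \<and> n = m + 1 \<longrightarrow> traceable G) \<and>
         (card V1 = card V2 \<and> m = n \<longrightarrow> hamiltonian G)"
proof -
  have "pair_graph G"
    and deg_seq: "degree_sequence G = replicate_mset m (m - 1) + replicate_mset n (n - 1)"
    and not_iso: "\<not> digraph_iso (with_proj G) (with_proj (disjoint_cliques m n))"
    using assms(4) by (auto simp: clique_pair_class_def degree_sequence_disjoint_cliques)
  interpret pair_graph G
    by fact
  interpret bipartite_clique_degrees G V1 V2 m n
    using assms(1,3,5) deg_seq by unfold_locales
  have "(card V1 = card V2 \<and> n = m + 2 \<and> even m \<and> even n) \<or>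
        (card V1 = m \<and> card V2 = n \<and> n = m + 1) \<or>
        (card V1 = card V2 \<and> m = n)"
  proof (cases "m = n")
    case True
    then show ?thesis
      using parts_eq_if_eq by simp
  next
    case False
    then have "m < n"
      using assms(3) by simp
    moreover have "even n" if "card V1 = card V2"
      using half_high_if_equal_parts(1)[OF \<open>m < n\<close> that] by (metis dvd_triv_left)
    ultimately show ?thesis
      using part_sizes_if_less assms(6) by auto
  qed
  then show ?thesis
    using hamiltonian_if_add_2 traceable_or_clique_pair_if_Suc hamiltonian_or_clique_pair_if_eq
      not_iso by blast
qed

end
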